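(* Let $n\ge 2$ and let $S=\{a_1,\dots,a_n\}$ be a multiset of nonnegative integers with at least two indices $i$ such that $a_i>0$. Then there exist integers $t_1,\dots,t_n$ with $t_i\ge a_i$ for all $i\in\{1,\dots,n\}$ such that $$t_1\oplus t_2\oplus\cdots\oplus t_n=(t_1-a_1)\oplus(t_2-a_2)\oplus\cdots\oplus(t_n-a_n)$$ if and only if $S$ is balanced.
   Context: For nonnegative integers, $\oplus$ denotes nim-sum, i.e. bitwise exclusive-or of binary expansions (addition without carry). For a nonnegative integer $s$, write $s=\sum_{j\ge 0}s^j2^j$ with $s^j\in\{0,1\}$; $s^j$ is the bit in position $j$ of $s$ (the superscript is an index, not a power). Let $S=\{a_1,\dots,a_n\}$ be a multiset (the $a_i$ need not be distinct) of nonnegative integers, not all zero. Let $\sigma=a_1\oplus\cdots\oplus a_n$, and let $k$ be the maximum integer such that $2^k$ divides $a_i$ for every $i\in\{1,\dots,n\}$ (equivalently, $k$ is the least significant binary position in which some $a_i$ has a 1-bit). $S$ is called balanced if $\sigma^k=0$, i.e. the bit in position $k$ of $\sigma$ is $0$. *)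

theory Defs
  imports "HOL-Library.Multiset"
begin

text \<open>
  On \<^typ>\<open>nat\<close>, \<open>xor\<close> is addition of binary expansions without carry.
  \<open>nim_sum S\<close> combines all members of a multiset (with multiplicity) by \<open>xor\<close>;
  its value on the empty multiset is 0.
\<close>

global_interpretation nim: comm_monoid_mset "xor :: nat \<Rightarrow> nat \<Rightarrow> nat" "0 :: nat"
  defines nim_sum = "comm_monoid_mset.F (xor :: nat \<Rightarrow> nat \<Rightarrow> nat) 0"
  by standard (simp_all add: ac_simps)

text \<open>
  The largest exponent \<open>k\<close> such that \<open>2 ^ k\<close> divides every member of \<open>S\<close>. The maximum
  exists only if \<open>S\<close> has a nonzero member; otherwise the value is unspecified.
\<close>

definition common_two_exponent :: "nat multiset \<Rightarrow> nat" where
  "common_two_exponent S = (GREATEST k. \<forall>x\<in>#S. 2 ^ k dvd x)"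

definition balanced :: "nat multiset \<Rightarrow> bool" where
  "balanced S \<longleftrightarrow> \<not> bit (nim_sum S) (common_two_exponent S)"

lemma common_two_exponent_properties:
  assumes "x \<in># S" "x \<noteq> 0"
  shows "\<forall>y\<in>#S. 2 ^ common_two_exponent S dvd y"
    and "\<forall>y\<in>#S. 2 ^ j dvd y \<Longrightarrow> j \<le> common_two_exponent S"
proof -
  have bound: "\<forall>k. (\<forall>y\<in>#S. 2 ^ k dvd y) \<longrightarrow> k \<le> x"
  proof (intro allI impI)
    fix k assume "\<forall>y\<in>#S. 2 ^ k dvd y"
    then have "2 ^ k \<le> x" using assms by (auto intro: dvd_imp_le)
    then show "k \<le> x" using less_exp[of k] by linarith
  qed
  show "\<forall>y\<in>#S. 2 ^ common_two_exponent S dvd y"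
    unfolding common_two_exponent_def
    by (rule GreatestI_nat[where k = 0 and b = x]) (use bound in auto)
  show "\<forall>y\<in>#S. 2 ^ j dvd y \<Longrightarrow> j \<le> common_two_exponent S"
    unfolding common_two_exponent_def
    by (rule Greatest_le_nat[where b = x]) (use bound in auto)
qed

end

theory Submission
  imports Defs
begin

text \<open>
  With \<open>s i = t i - a i\<close> the problem asks for numbers \<open>s i\<close> such that adding \<open>a i\<close> to each
  \<open>s i\<close> leaves the nim-sum unchanged. Bit \<open>j\<close> of a nim-sum is the parity of the sum of the
  quotients by \<open>2 ^ j\<close> (lemma \<open>bit_nim_sum_iff\<close>), so only parities of ordinary sums are needed.

  If such \<open>s i\<close> exist, then in position \<open>k\<close>, below which every \<open>a i\<close> vanishes, no carry has
  occurred. There the quotients of the \<open>a i\<close> are exactly what is added, so their sum is even,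
  which is balance.

  Conversely, divide out \<open>2 ^ k\<close>, so that the sum of the \<open>a i\<close> is even and some \<open>a i\<close> is odd, and
  choose the bits of the \<open>s i\<close> from the lowest one upwards. Choosing the lowest bit of \<open>s i\<close>
  replaces the rest of the problem by the same problem for half of \<open>a i\<close>, where an odd \<open>a i\<close>
  may be rounded down (bit 0) or up (bit 1, which produces a carry). The number of odd \<open>a i\<close> is
  even and positive, hence at least two: rounding one of them to an odd number keeps an odd
  number available for the next position, and rounding another one suitably makes the new sum
  even (lemma \<open>ex_rounding\<close>). So the choice never gets stuck, and halving leads to numbers that
  are at most 1; as their sum is even, \<open>s i = 0\<close> works for them.
\<close>

lemma bit_nim_sum_iff:
  fixes f :: "'a \<Rightarrow> nat"
  assumes "finite I"
  shows "bit (nim_sum {# f i. i \<in># mset_set I #}) j \<longleftrightarrow> odd (\<Sum>i\<in>I. f i div 2 ^ j)"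
  using assms by (induction I) (simp_all add: bit_xor_iff, auto simp: bit_iff_odd)

lemma nim_sum_eq_iff:
  fixes f g :: "'a \<Rightarrow> nat"
  assumes "finite I"
  shows "nim_sum {# f i. i \<in># mset_set I #} = nim_sum {# g i. i \<in># mset_set I #} \<longleftrightarrow>
    (\<forall>j. even (\<Sum>i\<in>I. f i div 2 ^ j) \<longleftrightarrow> even (\<Sum>i\<in>I. g i div 2 ^ j))"
  by (simp add: bit_eq_iff bit_nim_sum_iff[OF assms])

lemma nim_sum_mult_power_two:
  fixes f :: "'a \<Rightarrow> nat"
  assumes "finite I"
  shows "nim_sum {# 2 ^ k * f i. i \<in># mset_set I #} = 2 ^ k * nim_sum {# f i. i \<in># mset_set I #}"
  using assms by (induction I) (simp_all add: mult.commute[of "2 ^ k"] flip: push_bit_eq_mult)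

text \<open>
  Adding \<open>b i\<close> before halving rounds an odd \<open>A i\<close> up or down and has no effect on an even one.
  The two odd entries used are \<open>p\<close>, which is rounded to an odd number, and \<open>q\<close>, which corrects
  the parity of the sum.
\<close>

lemma ex_rounding:
  fixes A :: "'a \<Rightarrow> nat"
  assumes fin: "finite I" and ev: "even (\<Sum>i\<in>I. A i)" and p: "p \<in> I" "odd (A p)"
  obtains b :: "'a \<Rightarrow> nat" where "\<forall>i. b i \<le> 1"
    and "even (\<Sum>i\<in>I. (A i + b i) div 2)" and "\<exists>i\<in>I. odd ((A i + b i) div 2)"
proof -
  have "odd (\<Sum>i\<in>I - {p}. A i)"
    using ev p by (simp add: sum.remove[OF fin p(1)])
  then obtain q where q: "q \<in> I" "q \<noteq> p" "odd (A q)"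
    using dvd_sum[of "I - {p}" 2 A] by blast
  define c :: nat where "c = of_bool (even (A p div 2))"
  define R where "R = (\<Sum>i\<in>I - {p} - {q}. A i div 2)"
  define d :: nat where "d = of_bool (even (A q div 2 + R))"
  define b :: "'a \<Rightarrow> nat" where "b = (\<lambda>_. 0)(p := c, q := d)"
  have bp: "(A p + b p) div 2 = A p div 2 + c" and bq: "(A q + b q) div 2 = A q div 2 + d"
    using p q by (auto simp: b_def c_def d_def elim!: oddE)
  have odd_p: "odd ((A p + b p) div 2)"
    unfolding bp by (simp add: c_def)
  have "(\<Sum>i\<in>I - {p} - {q}. (A i + b i) div 2) = R"
    unfolding R_def b_def by (intro sum.cong) auto
  then have "(\<Sum>i\<in>I. (A i + b i) div 2) = (A p + b p) div 2 + (A q div 2 + d + R)"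
    using sum.remove[OF fin p(1), of "\<lambda>i. (A i + b i) div 2"]
      sum.remove[of "I - {p}" q "\<lambda>i. (A i + b i) div 2"] fin q bq by simp
  moreover have "odd (A q div 2 + d + R)"
    by (simp add: d_def)
  ultimately have "even (\<Sum>i\<in>I. (A i + b i) div 2)"
    using odd_p by simp
  moreover have "\<forall>i. b i \<le> 1"
    by (simp add: b_def c_def d_def)
  ultimately show thesis
    using that odd_p p(1) by blast
qed

text \<open>
  The numbers \<open>A i\<close> are what remains to be added from the current bit position on, with
  pending carries included. This is why no separate record of carries occurs in the induction,
  which runs over the sum of the \<open>A i\<close>.
\<close>

lemma ex_nim_sum_add_eq:
  fixes A :: "'a \<Rightarrow> nat"
  assumes "finite I" "even (\<Sum>i\<in>I. A i)" "\<exists>i\<in>I. odd (A i)"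
  shows "\<exists>s. nim_sum {# s i + A i. i \<in># mset_set I #} = nim_sum {# s i. i \<in># mset_set I #}"
  using assms
proof (induction "\<Sum>i\<in>I. A i" arbitrary: A rule: less_induct)
  case less
  show ?case
  proof (cases "\<forall>i\<in>I. A i \<le> 1")
    case True
    have "even (\<Sum>i\<in>I. A i div 2 ^ j)" for j
    proof (cases j)
      case 0
      then show ?thesis using less.prems by simp
    next
      case (Suc m)
      then have "A i div 2 ^ j = 0" if "i \<in> I" for i
        using that True by (auto simp: div_mult2_eq)
      then show ?thesis by simp
    qed
    then have "nim_sum {# 0 + A i. i \<in># mset_set I #} = nim_sum {# 0. i \<in># mset_set I #}"
      unfolding nim_sum_eq_iff[OF less.prems(1)] by simp
    then show ?thesis by (rule exI[where x = "\<lambda>_. 0"])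
  next
    case False
    obtain p where p: "p \<in> I" "odd (A p)"
      using less.prems(3) by blast
    obtain b where b: "\<forall>i. b i \<le> 1" "even (\<Sum>i\<in>I. (A i + b i) div 2)"
        "\<exists>i\<in>I. odd ((A i + b i) div 2)"
      by (rule ex_rounding[OF less.prems(1,2) p]) blast
    have "(\<Sum>i\<in>I. (A i + b i) div 2) < (\<Sum>i\<in>I. A i)"
    proof (rule sum_strict_mono_ex1[OF less.prems(1)])
      \<comment> \<open>An even \<open>A i\<close> may be 0, and then \<open>b i = 1\<close> still gives \<open>0\<close>, as \<open>1 div 2 = 0\<close>.\<close>
      have "(A i + b i) div 2 \<le> A i" for i
        using b(1)[rule_format, of i] by linarith
      then show "\<forall>i\<in>I. (A i + b i) div 2 \<le> A i" by blast
      have "(A i + b i) div 2 < A i" if "\<not> A i \<le> 1" for i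
        using b(1)[rule_format, of i] that by linarith
      then show "\<exists>i\<in>I. (A i + b i) div 2 < A i" using False by blast
    qed
    from less.hyps[OF this less.prems(1) b(2,3)] obtain s where
      "nim_sum {# s i + (A i + b i) div 2. i \<in># mset_set I #} = nim_sum {# s i. i \<in># mset_set I #}"
      by blast
    then have s: "even (\<Sum>i\<in>I. (s i + (A i + b i) div 2) div 2 ^ j) \<longleftrightarrow>
        even (\<Sum>i\<in>I. s i div 2 ^ j)" for j
      unfolding nim_sum_eq_iff[OF less.prems(1)] by blast
    have "even (\<Sum>i\<in>I. (2 * s i + b i + A i) div 2 ^ j) \<longleftrightarrow>
        even (\<Sum>i\<in>I. (2 * s i + b i) div 2 ^ j)" for j
    proof (cases j)
      case 0
      then show ?thesis using less.prems(2) by (simp add: sum.distrib)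
    next
      case (Suc m)
      have "(2 * s i + b i + A i) div 2 = s i + (A i + b i) div 2" for i
        by linarith
      moreover have "(2 * s i + b i) div 2 = s i" for i
        using b(1)[rule_format, of i] by linarith
      ultimately show ?thesis
        using s[of m] by (simp add: Suc div_mult2_eq)
    qed
    then have "nim_sum {# 2 * s i + b i + A i. i \<in># mset_set I #} =
        nim_sum {# 2 * s i + b i. i \<in># mset_set I #}"
      unfolding nim_sum_eq_iff[OF less.prems(1)] by blast
    then show ?thesis by (rule exI[where x = "\<lambda>i. 2 * s i + b i"])
  qed
qed

theorem theorem1:
  fixes n :: nat and a :: "nat \<Rightarrow> nat" and S :: "nat multiset"
  assumes "n \<ge> 2"
    and "S = {# a i. i \<in># mset_set {1..n} #}"
    and "card {i \<in> {1..n}. a i > 0} \<ge> 2"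
  shows "(\<exists>t :: nat \<Rightarrow> nat. (\<forall>i \<in> {1..n}. t i \<ge> a i) \<and>
            nim_sum {# t i. i \<in># mset_set {1..n} #} =
            nim_sum {# t i - a i. i \<in># mset_set {1..n} #})
          \<longleftrightarrow> balanced S"
proof -
  let ?I = "{1..n}"
  define k where "k = common_two_exponent S"
  have "{i \<in> ?I. a i > 0} \<noteq> {}"
    using assms(3) by (metis card.empty not_numeral_le_zero)
  then obtain x where x: "x \<in># S" "x \<noteq> 0"
    by (fastforce simp: assms(2))
  have dvd: "2 ^ k dvd a i" if "i \<in> ?I" for i
    using common_two_exponent_properties(1)[OF x] that by (auto simp: k_def assms(2))
  have "\<not> (\<forall>y\<in>#S. 2 ^ Suc k dvd y)"
    using common_two_exponent_properties(2)[OF x, of "Suc k"] by (auto simp: k_def)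
  then obtain p where p: "p \<in> ?I" "\<not> 2 ^ Suc k dvd a p"
    by (auto simp: assms(2))
  have odd_p: "odd (a p div 2 ^ k)"
    using p(2) dvd_div_iff_mult[OF _ dvd[OF p(1)], of 2] by simp
  have bal: "balanced S \<longleftrightarrow> even (\<Sum>i\<in>?I. a i div 2 ^ k)"
    unfolding balanced_def assms(2) k_def[unfolded assms(2), symmetric]
    by (simp add: bit_nim_sum_iff)
  show ?thesis
  proof
    assume "\<exists>t. (\<forall>i \<in> ?I. t i \<ge> a i) \<and>
      nim_sum {# t i. i \<in># mset_set ?I #} = nim_sum {# t i - a i. i \<in># mset_set ?I #}"
    then obtain t where t: "\<And>i. i \<in> ?I \<Longrightarrow> t i \<ge> a i"
      "nim_sum {# t i. i \<in># mset_set ?I #} = nim_sum {# t i - a i. i \<in># mset_set ?I #}"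
      by blast
    \<comment> \<open>Since \<open>2 ^ k\<close> divides \<open>a i\<close>, subtracting \<open>a i\<close> borrows nothing from position \<open>k\<close>.\<close>
    have "t i div 2 ^ k = (t i - a i) div 2 ^ k + a i div 2 ^ k" if "i \<in> ?I" for i
      using div_plus_div_distrib_dvd_right[OF dvd[OF that], of "t i - a i"] t(1)[OF that] by simp
    then have "(\<Sum>i\<in>?I. t i div 2 ^ k) =
        (\<Sum>i\<in>?I. (t i - a i) div 2 ^ k) + (\<Sum>i\<in>?I. a i div 2 ^ k)"
      by (simp add: sum.distrib)
    moreover have "even (\<Sum>i\<in>?I. t i div 2 ^ k) \<longleftrightarrow> even (\<Sum>i\<in>?I. (t i - a i) div 2 ^ k)"
      using t(2) unfolding nim_sum_eq_iff[OF finite_atLeastAtMost] by blast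
    ultimately show "balanced S"
      unfolding bal by (metis even_add)
  next
    assume "balanced S"
    then obtain s where s:
      "nim_sum {# s i + a i div 2 ^ k. i \<in># mset_set ?I #} = nim_sum {# s i. i \<in># mset_set ?I #}"
      using ex_nim_sum_add_eq[of ?I "\<lambda>i. a i div 2 ^ k"] odd_p p(1) bal by blast
    define t where "t i = 2 ^ k * (s i + a i div 2 ^ k)" for i
    have t: "t i = 2 ^ k * s i + a i" if "i \<in> ?I" for i
      using dvd[OF that] by (simp add: t_def distrib_left)
    have "{# t i - a i. i \<in># mset_set ?I #} = {# 2 ^ k * s i. i \<in># mset_set ?I #}"
      by (intro image_mset_cong) (simp add: t)
    then have "nim_sum {# t i. i \<in># mset_set ?I #} = nim_sum {# t i - a i. i \<in># mset_set ?I #}"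
      unfolding t_def using s by (simp add: nim_sum_mult_power_two)
    then show "\<exists>t. (\<forall>i \<in> ?I. t i \<ge> a i) \<and>
      nim_sum {# t i. i \<in># mset_set ?I #} = nim_sum {# t i - a i. i \<in># mset_set ?I #}"
      by (intro exI[of _ t]) (simp add: t)
  qed
qed

end
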